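(* Let $X$ be a real Banach space with norm $\|\cdot\|_X$. Let $(E_n)_{n=1}^\infty$ be a sequence of functionals $E_n:X\to[0,\infty)$ such that for all $m,n\in\mathbb{N}$, all $f,f_1,\dots,f_m\in X$ and all $c\in\mathbb{R}$ $$E_{m\cdot n}\Big(\sum_{k=1}^m f_k\Big)\le\sum_{k=1}^m E_n(f_k),\qquad E_n(cf)=|c|E_n(f),\qquad E_n(f)\le D_n\|f\|_X,\qquad E_n(f)\ge E_{n+1}(f),$$ where $D_n$ is a constant depending only on $E_n$ and not on $f$. For each $\delta>0$ let $S_\delta\in X^\sim$ be a non-negative-valued sub-linear bounded functional on $X$. Let $\mu:(0,\infty)\to(0,\infty)$ be a positive function and let $\varphi:[1,\infty)\to(0,\infty)$ be a strictly decreasing function with $\lim_{x\to\infty}\varphi(x)=0$, such that for each $0<\lambda<1$ there exist a point $X_0=X_0(\lambda)\ge\lambda^{-1}$ and a constant $C_\lambda>0$ with $\varphi(\lambda x)\le C_\lambda\varphi(x)$ for all $x>X_0$. Suppose that there exist $n_0\in\mathbb{N}$, constants $C_1,C_2,c_3$ with $c_3>0$ (independent of $n$ and $\delta$), and elements $h_n\in X$ such that for all $n\in\mathbb{N}$ with $n\ge n_0$ and all $\delta>0$ $$\|h_n\|_X\le C_1,\qquad S_\delta(h_n)\le C_2\min\Big\{1,\frac{\mu(\delta)}{\varphi(n)}\Big\},\qquad E_{4n}(h_n)\ge c_3>0.$$ Then for each abstract modulus of smoothness $\omega$ satisfying $\lim_{\delta\to0+}\omega(\delta)/\delta=\infty$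 there exists $f_\omega\in X$ such that $$S_\delta(f_\omega)=O(\omega(\mu(\delta)))\quad(\delta\to0+)$$ and $$E_n(f_\omega)\ne o(\omega(\varphi(n)))\quad(n\to\infty),\quad\text{i.e.,}\quad\limsup_{n\to\infty}\frac{E_n(f_\omega)}{\omega(\varphi(n))}>0.$$
   Context: $\mathbb{N}=\{1,2,\dots\}$. A functional $T:X\to\mathbb{R}$ on a normed space $X$ is called non-negative-valued sub-linear and bounded, written $T\in X^\sim$, iff for all $f,g\in X$, $c\in\mathbb{R}$: $T(f)\ge0$, $T(f+g)\le T(f)+T(g)$, $T(cf)=|c|T(f)$, and $\sup\{T(f):\|f\|_X\le1\}<\infty$. An abstract modulus of smoothness is a continuous, increasing (i.e. non-decreasing) function $\omega$ on $[0,\infty)$ with $0=\omega(0)<\omega(\delta_1)\le\omega(\delta_1+\delta_2)\le\omega(\delta_1)+\omega(\delta_2)$ for all $\delta_1,\delta_2>0$. *)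

theory Defs
  imports Complex_Main "HOL-Library.Landau_Symbols" "HOL-Library.Extended_Real"
begin

text \<open>The class \<open>X\<^sup>\<sim>\<close> of non-negative-valued sub-linear bounded functionals.
  Homogeneity is with respect to \<open>\<bar>c\<bar>\<close>, so members are continuous seminorms.\<close>

definition sublin_bounded :: "('a::real_normed_vector \<Rightarrow> real) set" where
  "sublin_bounded = {T.
     (\<forall>f. T f \<ge> 0) \<and>
     (\<forall>f g. T (f + g) \<le> T f + T g) \<and>
     (\<forall>c f. T (c *\<^sub>R f) = \<bar>c\<bar> * T f) \<and>
     bdd_above {T f | f. norm f \<le> 1}}"

text \<open>A modulus lives on \<open>[0,\<infinity>)\<close>; values of \<open>\<omega>\<close> at negative arguments are irrelevant.\<close>

definition abstract_modulus :: "(real \<Rightarrow> real) \<Rightarrow> bool" where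
  "abstract_modulus \<omega> \<longleftrightarrow>
     continuous_on {0..} \<omega> \<and> mono_on {0..} \<omega> \<and> \<omega> 0 = 0 \<and>
     (\<forall>\<delta>\<^sub>1>0. \<forall>\<delta>\<^sub>2>0. 0 < \<omega> \<delta>\<^sub>1 \<and> \<omega> \<delta>\<^sub>1 \<le> \<omega> (\<delta>\<^sub>1 + \<delta>\<^sub>2) \<and> \<omega> (\<delta>\<^sub>1 + \<delta>\<^sub>2) \<le> \<omega> \<delta>\<^sub>1 + \<omega> \<delta>\<^sub>2)"

end

theory Submission
  imports Defs
begin

text \<open>
  The proof is a gliding hump argument. Call \<open>f\<close> smooth if
  \<open>S\<^sub>\<delta> f \<le> K \<omega>(\<mu> \<delta>)\<close> for some \<open>K\<close> and all \<open>\<delta> > 0\<close>; each \<open>h\<^sub>n\<close> is smooth, and so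
  are finite linear combinations of them. If some smooth \<open>f\<close> has \<open>E\<^sub>n f \<ge> c \<omega>(\<phi> n)\<close> for
  infinitely many \<open>n\<close> and some \<open>c > 0\<close>, it proves the theorem. Otherwise every smooth \<open>f\<close>
  satisfies \<open>E\<^sub>n f = o(\<omega>(\<phi> n))\<close>, and this is used against itself: it makes it possible to
  choose indices \<open>n\<^sub>k\<close> growing so fast that in
  \<open>f = \<Sum>\<^sub>k a\<^sub>k h(n\<^sub>k)\<close>, \<open>a\<^sub>k = \<omega>(\<phi> n\<^sub>k)\<close>,

  \<^item> the part of the sum before the \<open>k\<close>-th term is negligible for \<open>E\<close> with index \<open>n\<^sub>k\<close>, compared
    with \<open>a\<^sub>k\<close> (finite sums being smooth),
  \<^item> the part after the \<open>k\<close>-th term is negligible because its norm is at most \<open>2 C\<^sub>1 a\<^sub>k\<^sub>+\<^sub>1\<close>, and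
    \<open>a\<^sub>k\<^sub>+\<^sub>1\<close> is small compared with \<open>a\<^sub>k / D(n\<^sub>k)\<close>,
  \<^item> \<open>a\<^sub>k\<close> at least halves and \<open>a\<^sub>k / \<phi>(n\<^sub>k)\<close> at least doubles in every step; the latter is where
    \<open>\<omega>(\<delta>)/\<delta> \<rightarrow> \<infinity>\<close> enters.

  Splitting \<open>a\<^sub>k h(n\<^sub>k)\<close> as \<open>f\<close> minus the two negligible parts, which doubles the index twice,
  gives \<open>E f \<ge> (c\<^sub>3/2) a\<^sub>k \<ge> (c\<^sub>3/2) \<omega>(\<phi>(2 n\<^sub>k))\<close> at index \<open>2 n\<^sub>k\<close> (\<open>isolate_summand\<close>). So \<open>E\<^sub>n f\<close>
  is not \<open>o(\<omega>(\<phi> n))\<close>. But by the third item \<open>f\<close> is smooth, a contradiction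
  (\<open>lacunary_modulus_sum\<close>): at scale \<open>x = \<mu> \<delta>\<close>, the series \<open>\<Sum>\<^sub>k a\<^sub>k min {1, x / \<phi>(n\<^sub>k)}\<close> is
  geometric on either side of the crossover \<open>\<phi>(n\<^sub>k) \<approx> x\<close>, hence comparable to its largest
  terms, which are \<open>O(\<omega> x)\<close>.
\<close>

section \<open>Geometrically growing or decaying sums\<close>

lemma sum_le_twice_first_if_halving:
  fixes a :: "nat \<Rightarrow> real"
  assumes nonneg: "\<And>j. a j \<ge> 0" and halving: "\<And>j. 2 * a (Suc j) \<le> a j"
  shows "sum a {m..<n} \<le> 2 * a m"
proof (cases "m < n")
  case True
  \<comment> \<open>Subtracting the last term makes the bound inductive.\<close>
  have "sum a {m..<Suc (m + k)} \<le> 2 * a m - a (m + k)" for k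
  proof (induction k)
    case (Suc k)
    then show ?case using halving[of "m + k"] by simp
  qed simp
  from this[of "n - Suc m"] show ?thesis
    using True nonneg[of "n - 1"] by simp
qed (use nonneg[of m] in simp)

lemma sum_le_twice_last_if_doubling:
  fixes r :: "nat \<Rightarrow> real"
  assumes nonneg: "\<And>j. r j \<ge> 0" and doubling: "\<And>j. 2 * r j \<le> r (Suc j)"
  shows "sum r {..<Suc n} \<le> 2 * r n"
proof (induction n)
  case 0
  then show ?case using nonneg[of 0] by simp
next
  case (Suc n)
  then show ?case using doubling[of n] by simp
qed

section \<open>Moduli of smoothness\<close>

lemma abstract_modulus_pos: "abstract_modulus \<omega> \<Longrightarrow> x > 0 \<Longrightarrow> \<omega> x > 0"
  unfolding abstract_modulus_def by blast

lemma abstract_modulus_mono: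
  "abstract_modulus \<omega> \<Longrightarrow> 0 \<le> x \<Longrightarrow> x \<le> y \<Longrightarrow> \<omega> x \<le> \<omega> y"
  unfolding abstract_modulus_def by (meson atLeast_iff mono_onD order_trans)

lemma abstract_modulus_mult_nat:
  assumes "abstract_modulus \<omega>" "x > 0"
  shows "\<omega> (real n * x) \<le> real n * \<omega> x"
proof (induction n)
  case 0
  then show ?case using assms(1) by (simp add: abstract_modulus_def)
next
  case (Suc n)
  show ?case
  proof (cases "n = 0")
    case False
    then have "\<omega> (real n * x + x) \<le> \<omega> (real n * x) + \<omega> x"
      using assms unfolding abstract_modulus_def by simp
    with Suc show ?thesis by (simp add: algebra_simps)
  qed simp
qed

text \<open>Subadditivity makes \<open>\<omega>(t)/t\<close> decreasing up to the factor 2, which handles \<open>x < t\<close>; for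
  \<open>x \<ge> t\<close> the bound is monotonicity.\<close>

lemma abstract_modulus_min_le:
  assumes \<omega>: "abstract_modulus \<omega>" and "x > 0" "t > 0"
  shows "\<omega> t * min 1 (x / t) \<le> 2 * \<omega> x"
proof (cases "t \<le> x")
  case True
  then show ?thesis
    using abstract_modulus_mono[OF \<omega>, of t x] abstract_modulus_pos[OF \<omega> \<open>x > 0\<close>] assms
    by simp
next
  case False
  define n where "n = nat \<lceil>t / x\<rceil>"
  have "t / x > 1" using False assms by simp
  then have "real n = of_int \<lceil>t / x\<rceil>" unfolding n_def by simp
  with \<open>t / x > 1\<close> have n: "t / x \<le> real n" "real n \<le> 2 * (t / x)"
    using ceiling_correct[of "t / x"] by linarith+
  have "\<omega> t \<le> \<omega> (real n * x)"
    using n(1) assms by (intro abstract_modulus_mono[OF \<omega>]) (auto simp: field_simps)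
  also have "\<dots> \<le> real n * \<omega> x"
    by (rule abstract_modulus_mult_nat[OF \<omega> \<open>x > 0\<close>])
  also have "\<dots> \<le> 2 * (t / x) * \<omega> x"
    using n(2) abstract_modulus_pos[OF \<omega> \<open>x > 0\<close>] by (intro mult_right_mono) auto
  finally show ?thesis
    using False assms by (simp add: field_simps)
qed

text \<open>If \<open>t\<^sub>J\<close> is the first of the numbers \<open>t\<^sub>j\<close> not exceeding \<open>x\<close>, the terms before \<open>J\<close> are at most
  \<open>x \<omega>(t\<^sub>j)/t\<^sub>j\<close> and grow geometrically up to \<open>j = J - 1\<close>, whereas those from \<open>J\<close> on are at most
  \<open>\<omega>(t\<^sub>j)\<close> and decay geometrically. The extreme terms are bounded by \<open>2 \<omega>(x)\<close> and \<open>\<omega>(x)\<close>.\<close>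

lemma lacunary_modulus_sum:
  assumes \<omega>: "abstract_modulus \<omega>" and "x > 0" and t_pos: "\<And>j. t j > 0"
    and t_lim: "t \<longlonglongrightarrow> 0"
    and halving: "\<And>j. 2 * \<omega> (t (Suc j)) \<le> \<omega> (t j)"
    and doubling: "\<And>j. 2 * (\<omega> (t j) / t j) \<le> \<omega> (t (Suc j)) / t (Suc j)"
  shows "(\<Sum>j<n. \<omega> (t j) * min 1 (x / t j)) \<le> 6 * \<omega> x"
proof -
  let ?b = "\<lambda>j. \<omega> (t j) * min 1 (x / t j)"
  have nonneg: "\<omega> (t j) \<ge> 0" for j
    using abstract_modulus_pos[OF \<omega> t_pos] by (simp add: less_imp_le)
  have b_nonneg: "?b j \<ge> 0" for j
    using nonneg[of j] t_pos[of j] \<open>x > 0\<close> by simp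
  have "\<exists>j. t j \<le> x"
    using order_tendstoD(2)[OF t_lim \<open>x > 0\<close>]
    by (auto simp: eventually_sequentially intro: less_imp_le)
  define J where "J = (LEAST j. t j \<le> x)"
  have tJ: "t J \<le> x"
    unfolding J_def by (rule LeastI_ex) fact
  have t_gt: "t j > x" if "j < J" for j
    using not_less_Least[of j "\<lambda>j. t j \<le> x"] that by (auto simp: J_def)
  have before: "(\<Sum>j<J. ?b j) \<le> 4 * \<omega> x"
  proof (cases J)
    case 0
    then show ?thesis using abstract_modulus_pos[OF \<omega> \<open>x > 0\<close>] by simp
  next
    case (Suc i)
    have eq: "?b j = x * (\<omega> (t j) / t j)" if "j \<le> i" for j
      using t_gt[of j] t_pos[of j] that Suc by simp
    have "(\<Sum>j<J. ?b j) = (\<Sum>j<Suc i. x * (\<omega> (t j) / t j))"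
      unfolding Suc by (rule sum.cong) (use eq in auto)
    also have "\<dots> \<le> 2 * (x * (\<omega> (t i) / t i))"
    proof (rule sum_le_twice_last_if_doubling)
      show "0 \<le> x * (\<omega> (t j) / t j)" for j
        using nonneg[of j] t_pos[of j] \<open>x > 0\<close> by simp
      show "2 * (x * (\<omega> (t j) / t j)) \<le> x * (\<omega> (t (Suc j)) / t (Suc j))" for j
        using mult_left_mono[OF doubling[of j], of x] \<open>x > 0\<close> by (simp add: mult_ac)
    qed
    also have "x * (\<omega> (t i) / t i) \<le> 2 * \<omega> x"
      using abstract_modulus_min_le[OF \<omega> \<open>x > 0\<close> t_pos, of i] eq[of i] by simp
    finally show ?thesis by simp
  qed
  have "(\<Sum>j\<in>{J..<J + n}. ?b j) \<le> (\<Sum>j\<in>{J..<J + n}. \<omega> (t j))"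
    using nonneg by (intro sum_mono) (simp add: mult_left_le)
  also have "\<dots> \<le> 2 * \<omega> (t J)"
    using nonneg halving by (rule sum_le_twice_first_if_halving)
  also have "\<omega> (t J) \<le> \<omega> x"
    using tJ t_pos[of J] by (intro abstract_modulus_mono[OF \<omega>]) auto
  finally have after: "(\<Sum>j\<in>{J..<J + n}. ?b j) \<le> 2 * \<omega> x" by simp
  have "(\<Sum>j<n. ?b j) \<le> (\<Sum>j<J + n. ?b j)"
    using b_nonneg by (intro sum_mono2) auto
  also have "\<dots> = (\<Sum>j<J. ?b j) + (\<Sum>j\<in>{J..<J + n}. ?b j)"
    by (simp add: lessThan_atLeast0 sum.atLeastLessThan_concat)
  finally show ?thesis using before after by simp
qed

section \<open>Sub-linear bounded functionals\<close>

lemma sublin_boundedD: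
  assumes "T \<in> sublin_bounded"
  shows "T f \<ge> 0" "T (f + g) \<le> T f + T g" "T (c *\<^sub>R f) = \<bar>c\<bar> * T f"
  using assms by (auto simp: sublin_bounded_def)

lemma sublin_bounded_le_norm:
  assumes "T \<in> sublin_bounded"
  obtains B where "\<And>f. T f \<le> B * norm f"
proof -
  have "bdd_above {T f | f. norm f \<le> 1}" using assms by (simp add: sublin_bounded_def)
  then obtain B where B: "\<And>f. norm f \<le> 1 \<Longrightarrow> T f \<le> B"
    by (auto simp: bdd_above_def)
  have "T f \<le> B * norm f" for f
  proof (cases "f = 0")
    case True
    then show ?thesis using sublin_boundedD(3)[OF assms, of 0 0] by simp
  next
    case False
    have "T f = T (norm f *\<^sub>R sgn f)" by (simp add: False sgn_div_norm)
    also have "\<dots> = norm f * T (sgn f)"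
      by (simp only: sublin_boundedD(3)[OF assms] abs_norm_cancel)
    also have "\<dots> \<le> norm f * B"
      by (intro mult_left_mono B) (simp_all add: norm_sgn)
    finally show ?thesis by (simp add: mult.commute)
  qed
  then show thesis using that by blast
qed

lemma sublin_bounded_sum_le:
  fixes n :: nat
  assumes "T \<in> sublin_bounded"
  shows "T (\<Sum>j<n. u j) \<le> (\<Sum>j<n. T (u j))"
proof (induction n)
  case 0
  then show ?case using sublin_boundedD(3)[OF assms, of 0 0] by simp
next
  case (Suc n)
  then show ?case
    using sublin_boundedD(2)[OF assms, of "\<Sum>j<n. u j" "u n"] by simp
qed

lemma sublin_bounded_limit_le:
  assumes T: "T \<in> sublin_bounded" and lim: "g \<longlonglongrightarrow> f" and le: "\<And>n. T (g n) \<le> M"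
  shows "T f \<le> M"
proof -
  obtain B where B: "\<And>f. T f \<le> B * norm f" using sublin_bounded_le_norm[OF T] by blast
  have "T f \<le> M + B * norm (f - g n)" for n
    using sublin_boundedD(2)[OF T, of "g n" "f - g n"] le[of n] B[of "f - g n"] by simp
  moreover have "(\<lambda>n. M + B * norm (f - g n)) \<longlonglongrightarrow> M + B * norm (f - f)"
    by (intro tendsto_intros lim)
  ultimately show ?thesis
    by (intro LIMSEQ_le_const[of _ M]) auto
qed

section \<open>The resonance argument\<close>

text \<open>Bounding the remainder by the first omitted coefficient alone is what allows each new
  index to be chosen from the previous one: no later choice can spoil the bound.\<close>

lemma halving_series:
  fixes v :: "nat \<Rightarrow> 'a::banach"
  assumes norm_le: "\<And>j. norm (v j) \<le> C" and nonneg: "\<And>j. a j \<ge> 0"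
    and halving: "\<And>j. 2 * a (Suc j) \<le> a j"
  obtains f where "(\<lambda>n. \<Sum>j<n. a j *\<^sub>R v j) \<longlonglongrightarrow> f"
    and "\<And>k. norm (f - (\<Sum>j<k. a j *\<^sub>R v j)) \<le> 2 * C * a k"
proof -
  let ?g = "\<lambda>n. \<Sum>j<n. a j *\<^sub>R v j"
  have C: "C \<ge> 0" using norm_le[of 0] norm_ge_zero order_trans by blast
  have term_le: "norm (a j *\<^sub>R v j) \<le> C * a j" for j
    using mult_left_mono[OF norm_le[of j] nonneg[of j]] nonneg[of j] by (simp add: mult.commute)
  have "summable a"
  proof (rule bounded_imp_summable[OF nonneg])
    show "sum a {..n} \<le> 2 * a 0" for n
      using sum_le_twice_first_if_halving[of a 0 "Suc n", OF nonneg halving]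
      by (simp only: atLeast0LessThan lessThan_Suc_atMost)
  qed
  then have "summable (\<lambda>j. a j *\<^sub>R v j)"
    by (intro summable_comparison_test'[where N = 0, OF summable_mult[where c = C] term_le])
  then have lim: "?g \<longlonglongrightarrow> suminf (\<lambda>j. a j *\<^sub>R v j)" by (rule summable_LIMSEQ)
  have "norm (?g n - ?g k) \<le> 2 * C * a k" if "n \<ge> k" for n k
  proof -
    have "?g n - ?g k = (\<Sum>j\<in>{k..<n}. a j *\<^sub>R v j)"
      using that by (simp add: lessThan_atLeast0 sum_diff_nat_ivl)
    also have "norm \<dots> \<le> (\<Sum>j\<in>{k..<n}. C * a j)"
      by (intro sum_norm_le term_le)
    also have "\<dots> \<le> C * (2 * a k)"
      unfolding sum_distrib_left[symmetric]
      by (intro mult_left_mono sum_le_twice_first_if_halving nonneg halving C)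
    finally show ?thesis by simp
  qed
  then have "norm (suminf (\<lambda>j. a j *\<^sub>R v j) - ?g k) \<le> 2 * C * a k" for k
    by (intro LIMSEQ_le_const2[OF tendsto_norm[OF tendsto_diff[OF lim tendsto_const]]]) auto
  with lim show thesis by (rule that)
qed

text \<open>The lower estimate that isolates one hump: \<open>u = (p + u + r) - (p + r)\<close> costs one doubling of
  the index, the sum \<open>p + r\<close> another one.\<close>

lemma isolate_summand:
  fixes E :: "nat \<Rightarrow> 'a::real_vector \<Rightarrow> real"
  assumes add: "\<And>n f g. n \<ge> 1 \<Longrightarrow> E (2 * n) (f + g) \<le> E n f + E n g"
    and minus: "\<And>n f. n \<ge> 1 \<Longrightarrow> E n (- f) = E n f"
    and "n \<ge> 1"
  shows "E (4 * n) u \<le> E (2 * n) (p + u + r) + E n p + E n r"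
proof -
  have "E (2 * (2 * n)) ((p + u + r) + - (p + r)) \<le> E (2 * n) (p + u + r) + E (2 * n) (- (p + r))"
    using \<open>n \<ge> 1\<close> by (intro add) simp
  also have "E (2 * n) (- (p + r)) = E (2 * n) (p + r)"
    using \<open>n \<ge> 1\<close> by (intro minus) simp
  also have "\<dots> \<le> E n p + E n r" using \<open>n \<ge> 1\<close> by (rule add)
  finally show ?thesis by simp
qed

theorem theorem3p1:
  fixes E :: "nat \<Rightarrow> 'a::banach \<Rightarrow> real"
    and D :: "nat \<Rightarrow> real"
    and S :: "real \<Rightarrow> 'a \<Rightarrow> real"
    and \<mu> \<phi> :: "real \<Rightarrow> real"
    and h :: "nat \<Rightarrow> 'a"
    and n\<^sub>0 :: nat
    and C\<^sub>1 C\<^sub>2 c\<^sub>3 :: real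
  assumes E_nonneg: "\<And>n f. n \<ge> 1 \<Longrightarrow> E n f \<ge> 0"
    and E_sum: "\<And>m n (f :: nat \<Rightarrow> 'a). m \<ge> 1 \<Longrightarrow> n \<ge> 1 \<Longrightarrow>
          E (m * n) (\<Sum>k=1..m. f k) \<le> (\<Sum>k=1..m. E n (f k))"
    and E_scale: "\<And>n c f. n \<ge> 1 \<Longrightarrow> E n (c *\<^sub>R f) = \<bar>c\<bar> * E n f"
    and E_bound: "\<And>n f. n \<ge> 1 \<Longrightarrow> E n f \<le> D n * norm f"
    and E_antimono: "\<And>n f. n \<ge> 1 \<Longrightarrow> E n f \<ge> E (n + 1) f"
    and S: "\<And>\<delta>. \<delta> > 0 \<Longrightarrow> S \<delta> \<in> sublin_bounded"
    and \<mu>_pos: "\<And>\<delta>. \<delta> > 0 \<Longrightarrow> \<mu> \<delta> > 0"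
    and \<phi>_pos: "\<And>x. x \<ge> 1 \<Longrightarrow> \<phi> x > 0"
    and \<phi>_decreasing: "strict_antimono_on {1..} \<phi>"
    and \<phi>_lim: "(\<phi> \<longlongrightarrow> 0) at_top"
    and \<phi>_dilation: "\<And>t. 0 < t \<Longrightarrow> t < 1 \<Longrightarrow>
          \<exists>X\<^sub>0 C. X\<^sub>0 \<ge> inverse t \<and> C > 0 \<and> (\<forall>x>X\<^sub>0. \<phi> (t * x) \<le> C * \<phi> x)"
    and n\<^sub>0: "n\<^sub>0 \<ge> 1"
    and c\<^sub>3: "c\<^sub>3 > 0"
    and h_norm: "\<And>n. n \<ge> n\<^sub>0 \<Longrightarrow> norm (h n) \<le> C\<^sub>1"
    and h_S: "\<And>n \<delta>. n \<ge> n\<^sub>0 \<Longrightarrow> \<delta> > 0 \<Longrightarrow> S \<delta> (h n) \<le> C\<^sub>2 * min 1 (\<mu> \<delta> / \<phi> (real n))"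
    and h_E: "\<And>n. n \<ge> n\<^sub>0 \<Longrightarrow> E (4 * n) (h n) \<ge> c\<^sub>3"
  shows "\<forall>\<omega>. abstract_modulus \<omega> \<longrightarrow> filterlim (\<lambda>\<delta>. \<omega> \<delta> / \<delta>) at_top (at_right 0) \<longrightarrow>
     (\<exists>f\<^sub>\<omega> :: 'a.
        (\<lambda>\<delta>. S \<delta> f\<^sub>\<omega>) \<in> O[at_right 0](\<lambda>\<delta>. \<omega> (\<mu> \<delta>)) \<and>
        (\<lambda>n. E n f\<^sub>\<omega>) \<notin> o(\<lambda>n. \<omega> (\<phi> (real n))) \<and>
        limsup (\<lambda>n. ereal (E n f\<^sub>\<omega> / \<omega> (\<phi> (real n)))) > 0)"
proof (intro allI impI)
  fix \<omega> :: "real \<Rightarrow> real"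
  assume \<omega>: "abstract_modulus \<omega>" and \<omega>_lim: "filterlim (\<lambda>\<delta>. \<omega> \<delta> / \<delta>) at_top (at_right 0)"
  define a where "a n = \<omega> (\<phi> (real n))" for n :: nat
  define smooth where "smooth f \<longleftrightarrow> (\<exists>K. \<forall>\<delta>>0. S \<delta> f \<le> K * \<omega> (\<mu> \<delta>))" for f

  have \<phi>n: "\<phi> (real n) > 0" if "n \<ge> 1" for n :: nat
    using that by (intro \<phi>_pos) simp
  have a_pos: "a n > 0" if "n \<ge> 1" for n
    unfolding a_def using \<phi>n[OF that] by (rule abstract_modulus_pos[OF \<omega>])
  have \<phi>_lim_nat: "(\<lambda>n. \<phi> (real n)) \<longlonglongrightarrow> 0"
    by (rule filterlim_compose[OF \<phi>_lim filterlim_real_sequentially])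
  then have \<phi>_at_right: "filterlim (\<lambda>n. \<phi> (real n)) (at_right 0) sequentially"
    by (auto simp: filterlim_at eventually_sequentially intro!: exI[of _ 1] \<phi>_pos
        dest: \<phi>n less_imp_neq)
  have a_lim: "a \<longlonglongrightarrow> 0"
  proof -
    have cont: "continuous_on {0..} \<omega>" and zero: "\<omega> 0 = 0"
      using \<omega> by (auto simp: abstract_modulus_def)
    have "(\<omega> \<longlongrightarrow> \<omega> 0) (at 0 within {0..})"
      using bspec[OF iffD1[OF continuous_on_def cont], of 0] by simp
    then have "(\<omega> \<longlongrightarrow> 0) (at_right 0)"
      unfolding zero by (rule tendsto_within_subset) auto
    from filterlim_compose[OF this \<phi>_at_right] show ?thesis by (simp add: a_def[abs_def])
  qed
  have ratio_lim: "filterlim (\<lambda>n. a n / \<phi> (real n)) at_top sequentially"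
    unfolding a_def by (rule filterlim_compose[OF \<omega>_lim \<phi>_at_right])
  have a_double_le: "a (2 * n) \<le> a n" if "n \<ge> 1" for n
  proof -
    have "\<phi> (real (2 * n)) < \<phi> (real n)"
      using that by (intro monotone_onD[OF \<phi>_decreasing]) auto
    then show ?thesis unfolding a_def
      using \<phi>n[of "2 * n"] that by (intro abstract_modulus_mono[OF \<omega>]) auto
  qed

  have C\<^sub>1: "C\<^sub>1 \<ge> 0" using h_norm[of n\<^sub>0] norm_ge_zero[of "h n\<^sub>0"] by linarith
  have C\<^sub>2: "C\<^sub>2 \<ge> 0"
  proof -
    have "0 \<le> C\<^sub>2 * min 1 (\<mu> 1 / \<phi> (real n\<^sub>0))"
      using h_S[of n\<^sub>0 1] sublin_boundedD(1)[OF S[of 1], of "h n\<^sub>0"] by simp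
    moreover have "min 1 (\<mu> 1 / \<phi> (real n\<^sub>0)) > 0" using \<phi>n[OF n\<^sub>0] \<mu>_pos[of 1] by simp
    ultimately show ?thesis by (simp add: zero_le_mult_iff)
  qed

  have E_add: "E (2 * n) (f + g) \<le> E n f + E n g" if "n \<ge> 1" for n f g
    using E_sum[of 2 n "\<lambda>k. if k = 1 then f else g"] that
    by (simp add: numeral_2_eq_2)
  have E_minus: "E n (- f) = E n f" if "n \<ge> 1" for n f
    using E_scale[OF that, of "-1" f] by simp

  have smooth_zero: "smooth 0"
    unfolding smooth_def
    using sublin_boundedD(3)[OF S, of _ 0 0] by (intro exI[of _ 0]) simp
  have smooth_add_hump: "smooth (g + a n *\<^sub>R h n)" if g: "smooth g" and n: "n \<ge> n\<^sub>0" for g n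
  proof -
    from g obtain K where K: "\<And>\<delta>. \<delta> > 0 \<Longrightarrow> S \<delta> g \<le> K * \<omega> (\<mu> \<delta>)"
      unfolding smooth_def by blast
    have "n \<ge> 1" using n n\<^sub>0 by simp
    have "S \<delta> (g + a n *\<^sub>R h n) \<le> (K + 2 * C\<^sub>2) * \<omega> (\<mu> \<delta>)" if "\<delta> > 0" for \<delta>
    proof -
      have "S \<delta> (g + a n *\<^sub>R h n) \<le> S \<delta> g + a n * S \<delta> (h n)"
        using sublin_boundedD(2)[OF S[OF that], of g "a n *\<^sub>R h n"]
          sublin_boundedD(3)[OF S[OF that], of "a n" "h n"] a_pos[OF \<open>n \<ge> 1\<close>] by simp
      also have "a n * S \<delta> (h n) \<le> a n * (C\<^sub>2 * min 1 (\<mu> \<delta> / \<phi> (real n)))"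
        using a_pos[OF \<open>n \<ge> 1\<close>] by (intro mult_left_mono h_S n that) simp
      also have "\<dots> = C\<^sub>2 * (\<omega> (\<phi> (real n)) * min 1 (\<mu> \<delta> / \<phi> (real n)))"
        by (simp add: a_def)
      also have "\<dots> \<le> C\<^sub>2 * (2 * \<omega> (\<mu> \<delta>))"
        by (intro mult_left_mono abstract_modulus_min_le[OF \<omega>] \<mu>_pos that \<phi>n C\<^sub>2 \<open>n \<ge> 1\<close>)
      also have "S \<delta> g \<le> K * \<omega> (\<mu> \<delta>)" by (rule K[OF that])
      finally show ?thesis by (simp add: algebra_simps)
    qed
    then show ?thesis unfolding smooth_def by blast
  qed

  have "\<exists>f. smooth f \<and> (\<exists>c>0. \<exists>\<^sub>F n in sequentially. E n f \<ge> c * a n)"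
  proof (rule ccontr)
    assume "\<not> ?thesis"
    then have small: "\<forall>\<^sub>F n in sequentially. E n f < c * a n" if "smooth f" "c > 0" for f c
      using that by (auto simp: frequently_def not_le)

    \<comment> \<open>A state \<open>(n, g)\<close> consists of the current index and the sum of all earlier humps. The last
      clause of \<open>?Q\<close> anticipates that the humps after \<open>n\<close> have total norm at most \<open>2 C\<^sub>1 a n'\<close>.\<close>
    let ?P = "\<lambda>(k :: nat) (n, g). (k = 0 \<longrightarrow> g = 0) \<and> n \<ge> n\<^sub>0 \<and> smooth g \<and> E n g \<le> c\<^sub>3 / 4 * a n"
    let ?Q = "\<lambda>(n, g) (n', g'). n' > n \<and> g' = g + a n *\<^sub>R h n \<and> 2 * a n' \<le> a n
        \<and> 2 * (a n / \<phi> (real n)) \<le> a n' / \<phi> (real n')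
        \<and> \<bar>D n\<bar> * (2 * C\<^sub>1 * a n') \<le> c\<^sub>3 / 4 * a n"
    have "\<exists>s. \<forall>k. ?P k (s k) \<and> ?Q (s k) (s (Suc k))"
    proof (rule dependent_nat_choice)
      have "E n\<^sub>0 0 = 0" using E_scale[OF n\<^sub>0, of 0 0] by simp
      then have "?P 0 (n\<^sub>0, 0)"
        using smooth_zero a_pos[OF n\<^sub>0] c\<^sub>3 by simp
      then show "\<exists>s. ?P 0 s" ..
    next
      fix s :: "nat \<times> 'a" and k :: nat
      assume P: "?P k s"
      obtain n g where s: "s = (n, g)" by (cases s)
      have n: "n \<ge> n\<^sub>0" "n \<ge> 1" and g: "smooth g" using P n\<^sub>0 by (auto simp: s)
      have sm: "smooth (g + a n *\<^sub>R h n)" by (rule smooth_add_hump[OF g n(1)])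
      have "\<forall>\<^sub>F m in sequentially. E m (g + a n *\<^sub>R h n) < c\<^sub>3 / 4 * a m"
        using c\<^sub>3 by (intro small[OF sm]) simp
      moreover have "\<forall>\<^sub>F m in sequentially. m > n" by (rule eventually_gt_at_top)
      moreover have "\<forall>\<^sub>F m in sequentially. 2 * a m < a n"
        using tendsto_mult_right_zero[OF a_lim, of 2] a_pos[OF n(2)] by (rule order_tendstoD(2))
      moreover have "\<forall>\<^sub>F m in sequentially. 2 * (a n / \<phi> (real n)) \<le> a m / \<phi> (real m)"
        using ratio_lim by (auto simp: filterlim_at_top)
      moreover have "\<forall>\<^sub>F m in sequentially. \<bar>D n\<bar> * (2 * C\<^sub>1 * a m) < c\<^sub>3 / 4 * a n"
        using tendsto_mult_right_zero[OF tendsto_mult_right_zero[OF a_lim]] a_pos[OF n(2)] c\<^sub>3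
        by (intro order_tendstoD(2)) auto
      ultimately have "\<forall>\<^sub>F m in sequentially. ?P (Suc k) (m, g + a n *\<^sub>R h n) \<and> ?Q s (m, g + a n *\<^sub>R h n)"
        by eventually_elim (use n sm in \<open>auto simp: s\<close>)
      then have "\<exists>m. ?P (Suc k) (m, g + a n *\<^sub>R h n) \<and> ?Q s (m, g + a n *\<^sub>R h n)"
        by (rule eventually_happens'[OF sequentially_bot])
      then show "\<exists>s'. ?P (Suc k) s' \<and> ?Q s s'" by (elim exE) (rule exI)
    qed
    then obtain s :: "nat \<Rightarrow> nat \<times> 'a" where s: "\<forall>k. ?P k (s k) \<and> ?Q (s k) (s (Suc k))" ..
    define N where "N k = fst (s k)" for k
    define g where "g k = snd (s k)" for k
    have P: "N k \<ge> n\<^sub>0" "E (N k) (g k) \<le> c\<^sub>3 / 4 * a (N k)"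
      and g_0: "g 0 = 0" and Q: "N k < N (Suc k)" "g (Suc k) = g k + a (N k) *\<^sub>R h (N k)"
        "2 * a (N (Suc k)) \<le> a (N k)"
        "2 * (a (N k) / \<phi> (real (N k))) \<le> a (N (Suc k)) / \<phi> (real (N (Suc k)))"
        "\<bar>D (N k)\<bar> * (2 * C\<^sub>1 * a (N (Suc k))) \<le> c\<^sub>3 / 4 * a (N k)" for k
      using spec[OF s, of k] spec[OF s, of 0] by (auto simp: N_def g_def split_beta)
    have N1: "N k \<ge> 1" for k using P(1)[of k] n\<^sub>0 by simp
    have N_mono: "strict_mono N" using Q(1) by (simp add: strict_mono_Suc_iff)
    have aN_pos: "a (N k) > 0" for k using N1 by (rule a_pos)

    obtain f where f_lim: "(\<lambda>n. \<Sum>j<n. a (N j) *\<^sub>R h (N j)) \<longlonglongrightarrow> f"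
      and f_tail: "\<And>k. norm (f - (\<Sum>j<k. a (N j) *\<^sub>R h (N j))) \<le> 2 * C\<^sub>1 * a (N k)"
      by (rule halving_series[of "\<lambda>j. h (N j)" C\<^sub>1 "\<lambda>j. a (N j)"])
        (use h_norm[OF P(1)] aN_pos Q(3) in \<open>simp_all add: less_imp_le\<close>)
    have "S \<delta> f \<le> (C\<^sub>2 * 6) * \<omega> (\<mu> \<delta>)" if \<delta>: "\<delta> > 0" for \<delta>
    proof (rule sublin_bounded_limit_le[OF S[OF \<delta>] f_lim])
      fix n
      have "S \<delta> (\<Sum>j<n. a (N j) *\<^sub>R h (N j)) \<le> (\<Sum>j<n. S \<delta> (a (N j) *\<^sub>R h (N j)))"
        by (rule sublin_bounded_sum_le[OF S[OF \<delta>]])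
      also have "\<dots> \<le> (\<Sum>j<n. C\<^sub>2 * (\<omega> (\<phi> (real (N j))) * min 1 (\<mu> \<delta> / \<phi> (real (N j)))))"
      proof (rule sum_mono)
        fix j
        have "S \<delta> (a (N j) *\<^sub>R h (N j)) = a (N j) * S \<delta> (h (N j))"
          using sublin_boundedD(3)[OF S[OF \<delta>]] aN_pos[of j] by simp
        also have "\<dots> \<le> a (N j) * (C\<^sub>2 * min 1 (\<mu> \<delta> / \<phi> (real (N j))))"
          using aN_pos[of j] by (intro mult_left_mono h_S P \<delta>) simp
        finally show "S \<delta> (a (N j) *\<^sub>R h (N j))
            \<le> C\<^sub>2 * (\<omega> (\<phi> (real (N j))) * min 1 (\<mu> \<delta> / \<phi> (real (N j))))"
          by (simp add: a_def mult_ac)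
      qed
      also have "\<dots> \<le> C\<^sub>2 * (6 * \<omega> (\<mu> \<delta>))"
        unfolding sum_distrib_left[symmetric]
      proof (intro mult_left_mono lacunary_modulus_sum[OF \<omega>] \<mu>_pos \<delta> \<phi>n N1 C\<^sub>2)
        show "(\<lambda>j. \<phi> (real (N j))) \<longlonglongrightarrow> 0"
          using LIMSEQ_subseq_LIMSEQ[OF \<phi>_lim_nat N_mono] by (simp add: o_def)
      qed (use Q(3,4) in \<open>simp_all only: a_def\<close>)
      finally show "S \<delta> (\<Sum>j<n. a (N j) *\<^sub>R h (N j)) \<le> (C\<^sub>2 * 6) * \<omega> (\<mu> \<delta>)" by simp
    qed
    then have "smooth f" unfolding smooth_def by blast

    have sum_eq_g: "(\<Sum>j<k. a (N j) *\<^sub>R h (N j)) = g k" for k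
      by (induction k) (simp_all add: Q(2) g_0)
    have big: "E (2 * N k) f \<ge> c\<^sub>3 / 2 * a (2 * N k)" for k
    proof -
      let ?u = "a (N k) *\<^sub>R h (N k)" and ?r = "f - g (Suc k)"
      have "a (N k) * c\<^sub>3 \<le> a (N k) * E (4 * N k) (h (N k))"
        using aN_pos[of k] by (intro mult_left_mono h_E P) simp
      also have "\<dots> = E (4 * N k) ?u"
        using E_scale[of "4 * N k" "a (N k)" "h (N k)"] aN_pos[of k] N1[of k] by simp
      also have "\<dots> \<le> E (2 * N k) (g k + ?u + ?r) + E (N k) (g k) + E (N k) ?r"
        by (rule isolate_summand[of E, OF E_add E_minus N1])
      also have "g k + ?u + ?r = f" by (simp add: Q(2))
      also have "E (N k) ?r \<le> D (N k) * norm ?r" by (rule E_bound[OF N1])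
      also have "\<dots> \<le> \<bar>D (N k)\<bar> * (2 * C\<^sub>1 * a (N (Suc k)))"
        using f_tail[of "Suc k"] by (intro mult_mono) (auto simp: sum_eq_g)
      also have "\<dots> \<le> c\<^sub>3 / 4 * a (N k)" by (rule Q(5))
      finally have "c\<^sub>3 / 2 * a (N k) \<le> E (2 * N k) f" using P(2)[of k] by (simp add: field_simps)
      moreover have "c\<^sub>3 / 2 * a (2 * N k) \<le> c\<^sub>3 / 2 * a (N k)"
        using a_double_le[OF N1] c\<^sub>3 by (intro mult_left_mono) auto
      ultimately show ?thesis by linarith
    qed
    from small[OF \<open>smooth f\<close>, of "c\<^sub>3 / 2"] c\<^sub>3
    obtain M where M: "\<And>n. n \<ge> M \<Longrightarrow> E n f < c\<^sub>3 / 2 * a n"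
      by (auto simp: eventually_sequentially)
    have "2 * N M \<ge> M" using seq_suble[OF N_mono, of M] by simp
    from M[OF this] big[of M] show False by simp
  qed
  then obtain f c K where K: "\<And>\<delta>. \<delta> > 0 \<Longrightarrow> S \<delta> f \<le> K * \<omega> (\<mu> \<delta>)" and c: "c > 0"
    and freq: "\<exists>\<^sub>F n in sequentially. E n f \<ge> c * a n"
    unfolding smooth_def by blast

  have "(\<lambda>\<delta>. S \<delta> f) \<in> O[at_right 0](\<lambda>\<delta>. \<omega> (\<mu> \<delta>))"
  proof (rule bigoI)
    show "\<forall>\<^sub>F \<delta> in at_right 0. norm (S \<delta> f) \<le> K * norm (\<omega> (\<mu> \<delta>))"
      using eventually_at_right_less[of 0]
      by eventually_elim
        (use K sublin_boundedD(1)[OF S] abstract_modulus_pos[OF \<omega> \<mu>_pos] in \<open>simp add: less_imp_le\<close>)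
  qed
  moreover have "(\<lambda>n. E n f) \<notin> o(\<lambda>n. \<omega> (\<phi> (real n)))"
  proof
    assume "(\<lambda>n. E n f) \<in> o(\<lambda>n. \<omega> (\<phi> (real n)))"
    then have "\<forall>\<^sub>F n in sequentially. norm (E n f) \<le> c / 2 * norm (a n)"
      unfolding a_def using c by (intro landau_o.smallD) auto
    then have "\<forall>\<^sub>F n in sequentially. \<not> E n f \<ge> c * a n"
      using eventually_ge_at_top[of 1]
    proof eventually_elim
      case (elim n)
      have "c / 2 * a n < c * a n" using c a_pos[OF elim(2)] by simp
      then show ?case using elim a_pos[OF elim(2)] E_nonneg[OF elim(2), of f] by simp
    qed
    then show False using freq by (simp add: frequently_def)
  qed
  moreover have "limsup (\<lambda>n. ereal (E n f / \<omega> (\<phi> (real n)))) > 0"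
  proof -
    have "\<exists>\<^sub>F n in sequentially. \<not> ereal (E n f / a n) < ereal c"
      using frequently_eventually_conj[OF freq eventually_ge_at_top[of 1]]
      by (rule frequently_elim1) (use a_pos in \<open>auto simp: pos_le_divide_eq not_less\<close>)
    then have "ereal c \<le> limsup (\<lambda>n. ereal (E n f / a n))"
      using Limsup_lessD[of sequentially "\<lambda>n. ereal (E n f / a n)" "ereal c"]
      by (auto simp: frequently_def not_le[symmetric])
    then show ?thesis unfolding a_def using c by (metis ereal_less(2) less_le_trans)
  qed
  ultimately show "\<exists>f. (\<lambda>\<delta>. S \<delta> f) \<in> O[at_right 0](\<lambda>\<delta>. \<omega> (\<mu> \<delta>)) \<and>
      (\<lambda>n. E n f) \<notin> o(\<lambda>n. \<omega> (\<phi> (real n))) \<and>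
      limsup (\<lambda>n. ereal (E n f / \<omega> (\<phi> (real n)))) > 0"
    by blast
qed

end
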